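(* For integers $m,n\ge 2$, the number of vertices of degree $3$ in $\mathrm{OFG}(M_{m,n})$ is $4(m+n-4)$.
   Context: $G_{m,n}$ is the grid graph with vertex set $\{(i,j): 1\le i\le m,\ 1\le j\le n\}$, each vertex joined to its horizontal and vertical neighbours. A proper $3$-colouring is a map $c:V(G_{m,n})\to\mathbb{Z}/3\mathbb{Z}$ with $c(u)\ne c(v)$ for every edge $uv$. $\mathrm{OFG}(M_{m,n})$ is the origami flip graph of the $m\times n$ Miura-ori (vertices: flat-foldable mountain--valley assignments; edges: single face flips). Throughout it is identified, by a known bijection, with the following simple graph: its vertices are the orbits of proper $3$-colourings of $G_{m,n}$ under the global colour rotation $c\mapsto c+1$ (action of $\mathbb{Z}/3\mathbb{Z}$), and two distinct orbits are adjacent if and only if they contain representatives that differ at exactly one vertex of $G_{m,n}$. *)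

theory Defs
  imports Main "HOL-Library.FuncSet" "HOL-Library.Numeral_Type"
begin

text \<open>A simple graph is a pair of a vertex set and a set of two-element edges.\<close>

type_synonym 'a sgraph = "'a set \<times> 'a set set"

abbreviation verts :: "'a sgraph \<Rightarrow> 'a set" where
  "verts G \<equiv> fst G"

abbreviation edges :: "'a sgraph \<Rightarrow> 'a set set" where
  "edges G \<equiv> snd G"

definition degree :: "'a sgraph \<Rightarrow> 'a \<Rightarrow> nat" where
  "degree G v = card {e \<in> edges G. v \<in> e}"

definition grid :: "nat \<Rightarrow> nat \<Rightarrow> (nat \<times> nat) sgraph" where
  "grid m n =
    ({1..m} \<times> {1..n},
     {{(i, j), (i + 1, j)} | i j. 1 \<le> i \<and> i + 1 \<le> m \<and> 1 \<le> j \<and> j \<le> n} \<union>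
     {{(i, j), (i, j + 1)} | i j. 1 \<le> i \<and> i \<le> m \<and> 1 \<le> j \<and> j + 1 \<le> n})"

text \<open>The numeral type \<open>3\<close> is the ring of integers modulo 3, with wrap-around addition.
  Colourings are extensional (\<open>undefined\<close> off the vertex set), so that equality of
  functions is equality on the vertices.\<close>

definition proper_colourings :: "'a sgraph \<Rightarrow> ('a \<Rightarrow> 3) set" where
  "proper_colourings G =
    {c \<in> verts G \<rightarrow>\<^sub>E UNIV. \<forall>u v. {u, v} \<in> edges G \<longrightarrow> c u \<noteq> c v}"

definition rotate_colouring :: "'a sgraph \<Rightarrow> 3 \<Rightarrow> ('a \<Rightarrow> 3) \<Rightarrow> ('a \<Rightarrow> 3)" where
  "rotate_colouring G k c = (\<lambda>v\<in>verts G. c v + k)"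

definition colour_orbit :: "'a sgraph \<Rightarrow> ('a \<Rightarrow> 3) \<Rightarrow> ('a \<Rightarrow> 3) set" where
  "colour_orbit G c = range (\<lambda>k. rotate_colouring G k c)"

definition differ_at_one :: "'a sgraph \<Rightarrow> ('a \<Rightarrow> 3) \<Rightarrow> ('a \<Rightarrow> 3) \<Rightarrow> bool" where
  "differ_at_one G c d \<longleftrightarrow> (\<exists>!v. v \<in> verts G \<and> c v \<noteq> d v)"

text \<open>The origami flip graph of the \<open>m\<close> by \<open>n\<close> Miura-ori, in its 3-colouring model:
  flat-foldable mountain-valley assignments correspond to colourings of the grid up to
  rotation of the colours, and a face flip recolours a single vertex.\<close>

definition OFG :: "nat \<Rightarrow> nat \<Rightarrow> (nat \<times> nat \<Rightarrow> 3) set sgraph" where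
  "OFG m n =
    (let V = colour_orbit (grid m n) ` proper_colourings (grid m n)
     in (V, {{A, B} | A B. A \<in> V \<and> B \<in> V \<and> A \<noteq> B \<and>
               (\<exists>c\<in>A. \<exists>d\<in>B. differ_at_one (grid m n) c d)}))"

end

theory Submission
  imports Defs
begin

text \<open>
  A proper 3-colouring of the grid lifts to an integer height function that changes by
  \<open>\<plusminus>1\<close> along every edge, because the steps around each unit square cancel. A vertex can be
  recoloured exactly when it is a local extremum of the height, so the degree of an orbit
  is the number of local extrema. There is always at least one minimum and one maximum;
  degree 3 therefore means that one kind of extremum is attained at a single vertex \<open>p\<close> only.
  Walking downhill from any vertex then ends at \<open>p\<close>, which forces the height to be the distance
  to \<open>p\<close> up to sign and a constant. The opposite extrema are corners of the grid, and there are
  1, 2 or 4 of them according as \<open>p\<close> is a corner, another boundary vertex, or an interior vertex.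
  Hence the orbits of degree 3 correspond to a sign and one of the \<open>2(m + n - 4)\<close> boundary
  vertices that are not corners.
\<close>

section \<open>Arithmetic of colours modulo 3\<close>

lemma mod3_exhaust: "(x::3) = 0 \<or> x = 1 \<or> x = 2"
proof (cases x)
  case (of_int z)
  then have "z \<in> {0, 1, 2}" by auto
  then show ?thesis using of_int by auto
qed

lemma mod3_of_int_eq_iff:
  assumes "\<bar>a - b\<bar> < 3"
  shows "(of_int a :: 3) = of_int b \<longleftrightarrow> a = b"
proof -
  have *: "(of_int t :: 3) = 0 \<longleftrightarrow> t = 0" if "t \<in> {-2, -1, 0, 1, 2}" for t
    using that by auto
  have "a - b \<in> {-2, -1, 0, 1, 2}" using assms by auto
  from *[OF this] show ?thesis by simp
qed

text \<open>If a vertex changes from \<open>a\<close> to \<open>b\<close>, each neighbour is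
  confined to the one remaining colour, on the other side of \<open>a\<close> from
  \<open>b\<close>.\<close>

lemma mod3_third_colour:
  fixes a b :: 3
  assumes "b \<noteq> a" "x \<noteq> a" "x \<noteq> b"
  shows "b = a + 1 \<and> x = a - 1 \<or> b = a - 1 \<and> x = a + 1"
  using assms mod3_exhaust[of a] mod3_exhaust[of b] mod3_exhaust[of x]
  by (elim disjE) simp_all

text \<open>The lift of \<open>b - a\<close> to -1 or 1. It is meaningful for distinct colours only:
  \<open>a = b\<close> also yields -1.\<close>

definition colour_step :: "3 \<Rightarrow> 3 \<Rightarrow> int" where
  "colour_step a b = (if b = a + 1 then 1 else - 1)"

lemma of_int_colour_step:
  assumes "a \<noteq> b"
  shows "of_int (colour_step a b) = b - a"
  using assms mod3_exhaust[of a] mod3_exhaust[of b]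
  by (elim disjE) (simp_all add: colour_step_def)

text \<open>Both sides lie in {-2, 0, 2}, whose elements are pairwise incongruent modulo 3, and both
  reduce to \<open>d - a\<close>. Lifted steps therefore cancel around a unit square.\<close>

lemma colour_step_square:
  assumes "a \<noteq> b" "a \<noteq> c" "b \<noteq> d" "c \<noteq> d"
  shows "colour_step a b + colour_step b d = colour_step a c + colour_step c d"
  using assms mod3_exhaust[of a] mod3_exhaust[of b] mod3_exhaust[of c] mod3_exhaust[of d]
  by (elim disjE) (simp_all add: colour_step_def)

section \<open>Taxicab distance on the grid\<close>

definition grid_dist :: "nat \<times> nat \<Rightarrow> nat \<times> nat \<Rightarrow> int" where
  "grid_dist u v = \<bar>int (fst u) - int (fst v)\<bar> + \<bar>int (snd u) - int (snd v)\<bar>"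

lemma grid_dist_commute: "grid_dist u v = grid_dist v u"
  by (simp add: grid_dist_def abs_minus_commute)

lemma grid_dist_triangle: "grid_dist u w \<le> grid_dist u v + grid_dist v w"
  by (simp add: grid_dist_def)

lemma grid_dist_nonneg [simp]: "0 \<le> grid_dist u v"
  by (simp add: grid_dist_def)

lemma grid_dist_eq_0_iff [simp]: "grid_dist u v = 0 \<longleftrightarrow> u = v"
  by (cases u; cases v) (auto simp: grid_dist_def)

lemma grid_dist_eq_1_iff:
  "grid_dist (a, b) (c, d) = 1 \<longleftrightarrow>
     c = a + 1 \<and> b = d \<or> a = c + 1 \<and> b = d \<or> a = c \<and> d = b + 1 \<or> a = c \<and> b = d + 1"
proof -
  have "\<bar>x\<bar> + \<bar>y\<bar> = 1 \<longleftrightarrow> x = - 1 \<and> y = 0 \<or> x = 1 \<and> y = 0 \<or> x = 0 \<and> y = - 1 \<or> x = 0 \<and> y = 1"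
    for x y :: int
    by auto
  from this[of "int a - int c" "int b - int d"] show ?thesis
    unfolding grid_dist_def fst_conv snd_conv by auto
qed

lemma verts_grid: "verts (grid m n) = {1..m} \<times> {1..n}"
  by (simp add: grid_def)

lemma edge_grid_iff:
  "{u, v} \<in> edges (grid m n) \<longleftrightarrow>
     u \<in> verts (grid m n) \<and> v \<in> verts (grid m n) \<and> grid_dist u v = 1"
proof -
  obtain a b c d where uv: "u = (a, b)" "v = (c, d)" by fastforce
  have "{u, v} \<in> edges (grid m n) \<longleftrightarrow>
      (c = a + 1 \<and> b = d \<or> a = c + 1 \<and> b = d \<or> a = c \<and> d = b + 1 \<or> a = c \<and> b = d + 1)
      \<and> {a, c} \<subseteq> {1..m} \<and> {b, d} \<subseteq> {1..n}"
    unfolding uv grid_def by (simp add: doubleton_eq_iff) auto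
  also have "(c = a + 1 \<and> b = d \<or> a = c + 1 \<and> b = d \<or> a = c \<and> d = b + 1 \<or> a = c \<and> b = d + 1)
      \<longleftrightarrow> grid_dist u v = 1"
    unfolding uv grid_dist_eq_1_iff ..
  finally show ?thesis unfolding uv verts_grid by auto
qed

lemma grid_dist_edge:
  assumes "{u, v} \<in> edges (grid m n)"
  shows "grid_dist p u = grid_dist p v + 1 \<or> grid_dist p u = grid_dist p v - 1"
proof -
  obtain a b c d where uv: "u = (a, b)" "v = (c, d)" by fastforce
  have "c = a + 1 \<and> b = d \<or> a = c + 1 \<and> b = d \<or> a = c \<and> d = b + 1 \<or> a = c \<and> b = d + 1"
    using assms unfolding uv edge_grid_iff grid_dist_eq_1_iff by blast
  then show ?thesis unfolding uv grid_dist_def by auto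
qed

text \<open>A coordinate that differs from that of \<open>p\<close> is moved one step towards it,
  which stays inside the rectangle. The inductions on distance below rest on this.\<close>

lemma closer_neighbour:
  assumes "p \<in> verts (grid m n)" "v \<in> verts (grid m n)" "v \<noteq> p"
  obtains u where "{u, v} \<in> edges (grid m n)" "grid_dist p u = grid_dist p v - 1"
proof -
  obtain a b c d where pv: "p = (a, b)" "v = (c, d)" by fastforce
  note coords = assms[unfolded pv verts_grid]
  define u where "u = (if c < a then (c + 1, d) else if a < c then (c - 1, d)
    else if d < b then (c, d + 1) else (c, d - 1))"
  have "u \<in> verts (grid m n)" "grid_dist u v = 1" "grid_dist p u = grid_dist p v - 1"
    using coords unfolding u_def pv verts_grid grid_dist_def by auto
  then show ?thesis using that[of u] assms by (simp add: edge_grid_iff)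
qed

section \<open>Lifting a colouring to integer heights\<close>

lemma proper_colouring_edge:
  assumes "c \<in> proper_colourings G" "{u, v} \<in> edges G"
  shows "c u \<noteq> c v"
  using assms by (simp add: proper_colourings_def)

text \<open>Lifted steps are summed along one fixed path from (1, 1). Edges in the second coordinate
  are then correct by construction; those in the first follow from the square relation.\<close>

lemma height_function:
  assumes c: "c \<in> proper_colourings (grid m n)"
  obtains h :: "nat \<times> nat \<Rightarrow> int" where
    "\<And>u v. {u, v} \<in> edges (grid m n) \<Longrightarrow>
       (h v = h u + 1 \<or> h v = h u - 1) \<and> c v - c u = of_int (h v - h u)"
proof -
  define s where "s u v = colour_step (c u) (c v)" for u v
  \<comment> \<open>The path runs in the first coordinate along \<open>j = 1\<close>, then in the
    second; empty sums give height 0 at (1, 1).\<close>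
  define h where "h = (\<lambda>(i, j). (\<Sum>k = 1..<i. s (k, 1) (k + 1, 1)) + (\<Sum>l = 1..<j. s (i, l) (i, l + 1)))"
  have right: "h (i, j + 1) - h (i, j) = s (i, j) (i, j + 1)" if "1 \<le> j" for i j
    using that by (simp add: h_def)
  have edge: "{(i, j), (i + 1, j)} \<in> edges (grid m n)"
    if "1 \<le> i" "i + 1 \<le> m" "1 \<le> j" "j \<le> n" for i j
    using that by (auto simp: edge_grid_iff verts_grid grid_dist_def)
  have edge': "{(i, j), (i, j + 1)} \<in> edges (grid m n)"
    if "1 \<le> i" "i \<le> m" "1 \<le> j" "j + 1 \<le> n" for i j
    using that by (auto simp: edge_grid_iff verts_grid grid_dist_def)
  \<comment> \<open>At \<open>j = 1\<close> the step is itself a summand; each unit square carries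
    the identity from \<open>j\<close> to \<open>j + 1\<close>.\<close>
  have down: "h (i + 1, j) - h (i, j) = s (i, j) (i + 1, j)"
    if j: "1 \<le> j" "j \<le> n" and i: "1 \<le> i" "i + 1 \<le> m" for i j
    using j
  proof (induction j rule: dec_induct)
    case base
    then show ?case using i by (simp add: h_def)
  next
    case (step j)
    have "s (i, j) (i + 1, j) + s (i + 1, j) (i + 1, j + 1)
        = s (i, j) (i, j + 1) + s (i, j + 1) (i + 1, j + 1)"
      unfolding s_def using step i
      by (intro colour_step_square proper_colouring_edge[OF c] edge edge') auto
    then show ?case using step right[of j i] right[of j "i + 1"] by simp
  qed
  have *: "(h v = h u + 1 \<or> h v = h u - 1) \<and> c v - c u = of_int (h v - h u)"
    if "h v - h u = s u v" "{u, v} \<in> edges (grid m n)" for u v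
    using that(1) of_int_colour_step[OF proper_colouring_edge[OF c that(2)]]
    by (auto simp: s_def colour_step_def split: if_splits)
  have "(h v = h u + 1 \<or> h v = h u - 1) \<and> c v - c u = of_int (h v - h u)"
    if e: "{u, v} \<in> edges (grid m n)" for u v
  proof -
    have e': "{v, u} \<in> edges (grid m n)" using e by (simp add: insert_commute)
    \<comment> \<open>Edges are unordered, so the identity is known for one orientation only; the
      other one negates both differences.\<close>
    consider i j where "{u, v} = {(i, j), (i + 1, j)}" "1 \<le> i" "i + 1 \<le> m" "1 \<le> j" "j \<le> n"
      | i j where "{u, v} = {(i, j), (i, j + 1)}" "1 \<le> i" "i \<le> m" "1 \<le> j" "j + 1 \<le> n"
      using e unfolding grid_def snd_conv by blast
    then have "h v - h u = s u v \<or> h u - h v = s v u"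
    proof cases
      case 1
      then show ?thesis using down[of j i] by (auto simp: doubleton_eq_iff)
    next
      case 2
      then show ?thesis using right[of j i] by (auto simp: doubleton_eq_iff)
    qed
    then show ?thesis
    proof
      assume "h v - h u = s u v"
      from *[OF this e] show ?thesis .
    next
      assume "h u - h v = s v u"
      from *[OF this e'] have a: "h u = h v + 1 \<or> h u = h v - 1" "c u - c v = of_int (h u - h v)"
        by auto
      have "c v - c u = - of_int (h u - h v)" unfolding a(2)[symmetric] by simp
      then show ?thesis using a(1) by auto
    qed
  qed
  then show ?thesis using that by blast
qed

section \<open>Local extrema of the height\<close>

text \<open>The sign \<open>s = 1\<close> selects the local minima of the height function, \<open>s = - 1\<close> the local maxima.\<close>

definition local_extrema :: "(nat \<times> nat) sgraph \<Rightarrow> int \<Rightarrow> (nat \<times> nat \<Rightarrow> 3) \<Rightarrow> (nat \<times> nat) set" where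
  "local_extrema G s c = {v \<in> verts G. \<forall>u. {u, v} \<in> edges G \<longrightarrow> c u = c v + of_int s}"

lemma local_extremaD:
  "v \<in> local_extrema G s c \<Longrightarrow> {u, v} \<in> edges G \<Longrightarrow> c u = c v + of_int s"
  unfolding local_extrema_def by blast

lemma finite_local_extrema: "finite (local_extrema (grid m n) s c)"
  by (rule finite_subset[of _ "verts (grid m n)"]) (auto simp: local_extrema_def verts_grid)

text \<open>A vertex minimising \<open>s * h\<close> over the finite grid qualifies: heights of
  neighbours differ from its own by 1, and always in the direction \<open>s\<close>.\<close>

lemma local_extrema_nonempty:
  assumes c: "c \<in> proper_colourings (grid m n)" and s: "s = 1 \<or> s = - 1"
    and ne: "verts (grid m n) \<noteq> {}"
  shows "local_extrema (grid m n) s c \<noteq> {}"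
proof -
  obtain h where h: "\<And>u v. {u, v} \<in> edges (grid m n) \<Longrightarrow>
      (h v = h u + 1 \<or> h v = h u - 1) \<and> c v - c u = of_int (h v - h u)"
    using height_function[OF c] by blast
  have fin: "finite (verts (grid m n))" by (simp add: verts_grid)
  obtain p where p: "p \<in> verts (grid m n)" "\<And>v. v \<in> verts (grid m n) \<Longrightarrow> s * h p \<le> s * h v"
    using arg_min_if_finite[OF fin ne, of "\<lambda>v. s * h v"] by (meson not_less)
  have "c u = c p + of_int s" if e: "{u, p} \<in> edges (grid m n)" for u
  proof -
    have "s * h p \<le> s * h u" using p e by (simp add: edge_grid_iff)
    then have "h u - h p = s" using h[OF e] s by auto
    moreover have "c u = c p - of_int (h p - h u)"
      using h[OF e] by (metis diff_diff_eq2 add_diff_cancel_left')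
    ultimately show ?thesis by (simp add: algebra_simps)
  qed
  then show ?thesis using p unfolding local_extrema_def by blast
qed

text \<open>The function \<open>H = s * h\<close> grows from \<open>p\<close> by at least the
  distance, because a descent can stop only at \<open>p\<close>, and by at most the distance,
  because it changes by 1 per edge. Reduction modulo 3 gives the colours.\<close>

lemma unique_local_extremum:
  assumes c: "c \<in> proper_colourings (grid m n)" and s: "s = 1 \<or> s = - 1"
    and ext: "local_extrema (grid m n) s c = {p}" and v: "v \<in> verts (grid m n)"
  shows "c v = c p + of_int (s * grid_dist p v)"
proof -
  obtain h where h: "\<And>u v. {u, v} \<in> edges (grid m n) \<Longrightarrow>
      (h v = h u + 1 \<or> h v = h u - 1) \<and> c v - c u = of_int (h v - h u)"
    using height_function[OF c] by blast
  have pV: "p \<in> verts (grid m n)" using ext by (auto simp: local_extrema_def)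
  define H where "H v = s * h v" for v
  \<comment> \<open>The lower bound \<open>M\<close> makes the measure \<open>nat (H v - M)\<close>
    strictly drop whenever \<open>H\<close> does.\<close>
  define M where "M = Min (H ` verts (grid m n))"
  have fin: "finite (H ` verts (grid m n))" by (simp add: verts_grid)
  \<comment> \<open>Every vertex other than \<open>p\<close> has a lower neighbour, so some descending path leads to \<open>p\<close>.\<close>
  have lower: "H p + grid_dist p v \<le> H v" if "v \<in> verts (grid m n)" for v
    using that
  proof (induction "nat (H v - M)" arbitrary: v rule: less_induct)
    case less
    show ?case
    proof (cases "v = p")
      case False
      then have "v \<notin> local_extrema (grid m n) s c" using ext by simp
      then obtain u where e: "{u, v} \<in> edges (grid m n)" and ne: "c u \<noteq> c v + of_int s"
        using less.prems by (auto simp: local_extrema_def)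
      have "c u \<noteq> c v - of_int (- s)" using ne by simp
      then have "h v - h u \<noteq> - s"
        using h[OF e] by (metis diff_diff_eq2 add_diff_cancel_left')
      then have Hu: "H u = H v - 1" using h[OF e] s by (auto simp: H_def)
      have uV: "u \<in> verts (grid m n)" and d1: "grid_dist u v = 1"
        using e by (simp_all add: edge_grid_iff)
      have "M \<le> H u" unfolding M_def using fin uV by simp
      then have "H p + grid_dist p u \<le> H u"
        using Hu uV by (intro less.hyps) auto
      then show ?thesis using Hu d1 grid_dist_triangle[of p v u] by simp
    qed (simp add: grid_dist_def)
  qed
  have upper: "H v \<le> H p + grid_dist p v" if "v \<in> verts (grid m n)" for v
    using that
  proof (induction "nat (grid_dist p v)" arbitrary: v rule: less_induct)
    case less
    show ?case
    proof (cases "v = p")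
      case False
      then obtain u where e: "{u, v} \<in> edges (grid m n)" and d: "grid_dist p u = grid_dist p v - 1"
        using closer_neighbour pV less.prems by metis
      have "H u \<le> H p + grid_dist p u"
      proof (rule less.hyps)
        show "nat (grid_dist p u) < nat (grid_dist p v)"
          using d grid_dist_nonneg[of p u] by linarith
        show "u \<in> verts (grid m n)" using e by (simp add: edge_grid_iff)
      qed
      moreover have "H v \<le> H u + 1" using h[OF e] s by (auto simp: H_def)
      ultimately show ?thesis using d by simp
    qed (simp add: grid_dist_def)
  qed
  \<comment> \<open>Heights give colour differences along edges only, so these are added up along a
    shortest path from \<open>p\<close>.\<close>
  have colour: "c v - c p = of_int (h v - h p)" if "v \<in> verts (grid m n)" for v
    using that
  proof (induction "nat (grid_dist p v)" arbitrary: v rule: less_induct)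
    case less
    show ?case
    proof (cases "v = p")
      case False
      then obtain u where e: "{u, v} \<in> edges (grid m n)" and d: "grid_dist p u = grid_dist p v - 1"
        using closer_neighbour pV less.prems by metis
      have "c u - c p = of_int (h u - h p)"
      proof (rule less.hyps)
        show "nat (grid_dist p u) < nat (grid_dist p v)"
          using d grid_dist_nonneg[of p u] by linarith
        show "u \<in> verts (grid m n)" using e by (simp add: edge_grid_iff)
      qed
      moreover have "c v - c u = of_int (h v - h u)" using h[OF e] by simp
      ultimately have "(c v - c u) + (c u - c p) = of_int (h v - h u) + of_int (h u - h p)"
        by simp
      then show ?thesis by simp
    qed simp
  qed
  have "H v = H p + grid_dist p v" using lower upper v by (simp add: order_antisym)
  then have "h v - h p = s * grid_dist p v" using s by (auto simp: H_def)
  then show ?thesis using colour[OF v] by (metis diff_add_cancel add.commute)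
qed

section \<open>Distance colourings and their extrema\<close>

definition dist_colouring :: "(nat \<times> nat) sgraph \<Rightarrow> int \<Rightarrow> nat \<times> nat \<Rightarrow> (nat \<times> nat \<Rightarrow> 3)" where
  "dist_colouring G s p = (\<lambda>v\<in>verts G. of_int (s * grid_dist p v))"

lemma dist_colouring_proper:
  assumes "s = 1 \<or> s = - 1"
  shows "dist_colouring (grid m n) s p \<in> proper_colourings (grid m n)"
proof -
  have "dist_colouring (grid m n) s p u \<noteq> dist_colouring (grid m n) s p v"
    if e: "{u, v} \<in> edges (grid m n)" for u v
  proof -
    have "(of_int (s * grid_dist p u) :: 3) \<noteq> of_int (s * grid_dist p v)"
      using grid_dist_edge[OF e, of p] assms by (subst mod3_of_int_eq_iff) auto
    then show ?thesis using e by (simp add: dist_colouring_def edge_grid_iff)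
  qed
  then show ?thesis by (auto simp: proper_colourings_def dist_colouring_def)
qed

text \<open>Before reduction modulo 3 the two sides differ by at most 2, so congruence is equality.
  Extrema of sign \<open>t * s\<close> thus become local minima (\<open>t = 1\<close>) or local
  maxima (\<open>t = - 1\<close>) of the distance to \<open>p\<close>.\<close>

lemma dist_colouring_edge:
  assumes e: "{u, v} \<in> edges (grid m n)" and s: "s = 1 \<or> s = - 1" and t: "t = 1 \<or> t = - 1"
  shows "dist_colouring (grid m n) s p u = dist_colouring (grid m n) s p v + of_int (t * s)
    \<longleftrightarrow> grid_dist p u = grid_dist p v + t"
proof -
  have "(of_int (s * grid_dist p u) :: 3) = of_int (s * grid_dist p v + t * s)
      \<longleftrightarrow> s * grid_dist p u = s * grid_dist p v + t * s"
    using grid_dist_edge[OF e, of p] s t by (intro mod3_of_int_eq_iff) auto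
  moreover have "s * grid_dist p u = s * grid_dist p v + t * s \<longleftrightarrow> grid_dist p u = grid_dist p v + t"
    using s by auto
  moreover have "dist_colouring (grid m n) s p u = of_int (s * grid_dist p u)"
    "dist_colouring (grid m n) s p v + of_int (t * s) = of_int (s * grid_dist p v + t * s)"
    using e by (simp_all add: dist_colouring_def edge_grid_iff)
  ultimately show ?thesis by metis
qed

text \<open>Every vertex other than \<open>p\<close> has a neighbour closer to \<open>p\<close>, so
  the distance has no other local minimum.\<close>

lemma local_extrema_dist_colouring:
  assumes p: "p \<in> verts (grid m n)" and s: "s = 1 \<or> s = - 1"
  shows "local_extrema (grid m n) s (dist_colouring (grid m n) s p) = {p}"
proof -
  have "v \<in> local_extrema (grid m n) s (dist_colouring (grid m n) s p) \<longleftrightarrow> v = p"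
    if v: "v \<in> verts (grid m n)" for v
  proof -
    have "v \<in> local_extrema (grid m n) s (dist_colouring (grid m n) s p) \<longleftrightarrow>
        (\<forall>u. {u, v} \<in> edges (grid m n) \<longrightarrow> grid_dist p u = grid_dist p v + 1)"
      using v dist_colouring_edge[OF _ s, of _ v m n 1 p] unfolding local_extrema_def mem_Collect_eq
      by (metis mult_1)
    also have "\<dots> \<longleftrightarrow> v = p"
    proof
      assume a: "\<forall>u. {u, v} \<in> edges (grid m n) \<longrightarrow> grid_dist p u = grid_dist p v + 1"
      show "v = p"
      proof (rule ccontr)
        assume "v \<noteq> p"
        then obtain u where "{u, v} \<in> edges (grid m n)" "grid_dist p u = grid_dist p v - 1"
          using closer_neighbour p v by metis
        with a show False by fastforce
      qed
    next
      assume "v = p"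
      then show "\<forall>u. {u, v} \<in> edges (grid m n) \<longrightarrow> grid_dist p u = grid_dist p v + 1"
        using edge_grid_iff grid_dist_commute grid_dist_eq_0_iff by (metis add_0)
    qed
    finally show ?thesis .
  qed
  moreover have "local_extrema (grid m n) s (dist_colouring (grid m n) s p) \<subseteq> verts (grid m n)"
    by (auto simp: local_extrema_def)
  ultimately show ?thesis using p by blast
qed

text \<open>For \<open>a\<close> in \<open>{1..m}\<close> and \<open>m \<ge> 2\<close> these are the
  local maxima of the distance to \<open>a\<close> on a path with \<open>m\<close> vertices.\<close>

definition far_ends :: "nat \<Rightarrow> nat \<Rightarrow> nat set" where
  "far_ends m a = {x. x = 1 \<and> a \<noteq> 1 \<or> x = m \<and> a \<noteq> m}"

lemma card_far_ends:
  assumes "m \<ge> 2"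
  shows "card (far_ends m a) = (if a = 1 \<or> a = m then 1 else 2)"
proof -
  have "far_ends m a = (if a = 1 then {m} else if a = m then {1} else {1, m})"
    using assms by (auto simp: far_ends_def)
  then show ?thesis using assms by simp
qed

text \<open>The distance is a sum over the coordinates and an edge changes only one of them, so a
  local maximum is one in each coordinate separately.\<close>

lemma local_extrema_dist_colouring_opposite:
  assumes p: "(a, b) \<in> verts (grid m n)" and s: "s = 1 \<or> s = - 1" and mn: "m \<ge> 2" "n \<ge> 2"
  shows "local_extrema (grid m n) (- s) (dist_colouring (grid m n) s (a, b)) =
    far_ends m a \<times> far_ends n b"
proof -
  define E where "E = local_extrema (grid m n) (- s) (dist_colouring (grid m n) s (a, b))"
  have iff: "(x, y) \<in> E \<longleftrightarrow>
      (x, y) \<in> verts (grid m n) \<and>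
      (\<forall>u. {u, (x, y)} \<in> edges (grid m n) \<longrightarrow> grid_dist (a, b) u = grid_dist (a, b) (x, y) - 1)" for x y
    using dist_colouring_edge[OF _ s, of _ "(x, y)" m n "- 1" "(a, b)"]
    unfolding local_extrema_def E_def mem_Collect_eq
    by (simp only: mult_minus1 diff_conv_add_uminus) metis
  have "(x, y) \<in> E \<longleftrightarrow> x \<in> far_ends m a \<and> y \<in> far_ends n b" for x y
  proof
    assume "(x, y) \<in> E"
    then have xy: "1 \<le> x" "x \<le> m" "1 \<le> y" "y \<le> n"
      and nb: "\<And>u. u \<in> verts (grid m n) \<Longrightarrow> grid_dist u (x, y) = 1 \<Longrightarrow>
        grid_dist (a, b) u = grid_dist (a, b) (x, y) - 1"
      unfolding iff by (auto simp: verts_grid edge_grid_iff)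
    \<comment> \<open>All neighbours must be nearer to \<open>(a, b)\<close>: a neighbour above
      \<open>x\<close> forces \<open>x < a\<close>, one below forces \<open>a < x\<close>. Both
      cannot exist, so \<open>x\<close> is an end of its range, and likewise
      \<open>y\<close>.\<close>
    have 1: "x + 1 \<le> m \<Longrightarrow> x < a"
      using nb[of "(x + 1, y)"] xy by (simp add: verts_grid grid_dist_def split: abs_split)
    have 2: "a < x" if gt: "x > 1"
    proof -
      obtain x' where "x = Suc x'" "x' \<ge> 1" using gt by (cases x) auto
      then show ?thesis
        using nb[of "(x', y)"] xy by (simp add: verts_grid grid_dist_def split: abs_split)
    qed
    have 3: "y + 1 \<le> n \<Longrightarrow> y < b"
      using nb[of "(x, y + 1)"] xy by (simp add: verts_grid grid_dist_def split: abs_split)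
    have 4: "b < y" if gt: "y > 1"
    proof -
      obtain y' where "y = Suc y'" "y' \<ge> 1" using gt by (cases y) auto
      then show ?thesis
        using nb[of "(x, y')"] xy by (simp add: verts_grid grid_dist_def split: abs_split)
    qed
    show "x \<in> far_ends m a \<and> y \<in> far_ends n b"
      unfolding far_ends_def using 1 2 3 4 xy mn by simp linarith
  next
    assume "x \<in> far_ends m a \<and> y \<in> far_ends n b"
    then have xy: "(x = 1 \<and> a > 1 \<or> x = m \<and> a < m) \<and> (y = 1 \<and> b > 1 \<or> y = n \<and> b < n)"
      using p by (auto simp: far_ends_def verts_grid)
    have "grid_dist (a, b) u = grid_dist (a, b) (x, y) - 1"
      if "{u, (x, y)} \<in> edges (grid m n)" for u
    proof -
      obtain i j where u: "u = (i, j)" by fastforce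
      have "grid_dist u (x, y) = 1" and ij: "1 \<le> i" "i \<le> m" "1 \<le> j" "j \<le> n"
        using that by (auto simp: edge_grid_iff verts_grid u)
      from this(1) have "i = x \<and> (j = y + 1 \<or> y = j + 1) \<or> j = y \<and> (i = x + 1 \<or> x = i + 1)"
        unfolding u grid_dist_eq_1_iff by auto
      then show ?thesis
        using xy ij unfolding u grid_dist_def by auto
    qed
    then show "(x, y) \<in> E" unfolding iff using xy mn by (auto simp: verts_grid)
  qed
  then show ?thesis unfolding E_def by auto
qed

section \<open>Orbits under colour rotation\<close>

lemma rotate_colouring_apply [simp]: "v \<in> verts G \<Longrightarrow> rotate_colouring G k c v = c v + k"
  by (simp add: rotate_colouring_def)

lemma rotate_colouring_add:
  "rotate_colouring G k (rotate_colouring G l c) = rotate_colouring G (l + k) c"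
  by (auto simp: rotate_colouring_def fun_eq_iff add.assoc)

lemma rotate_colouring_0: "c \<in> verts G \<rightarrow>\<^sub>E UNIV \<Longrightarrow> rotate_colouring G 0 c = c"
  by (auto simp: rotate_colouring_def fun_eq_iff PiE_def extensional_def)

lemma proper_colouring_PiE: "c \<in> proper_colourings G \<Longrightarrow> c \<in> verts G \<rightarrow>\<^sub>E UNIV"
  by (simp add: proper_colourings_def)

lemma colour_orbit_self: "c \<in> proper_colourings G \<Longrightarrow> c \<in> colour_orbit G c"
  unfolding colour_orbit_def by (metis proper_colouring_PiE rangeI rotate_colouring_0)

lemma colour_orbit_rotate: "colour_orbit G (rotate_colouring G k c) = colour_orbit G c"
proof -
  have "range (\<lambda>l. rotate_colouring G (k + l) c) = (\<lambda>l. rotate_colouring G l c) ` range ((+) k)"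
    unfolding image_image ..
  also have "range ((+) k) = UNIV" by (rule surj_plus)
  finally show ?thesis by (simp add: colour_orbit_def rotate_colouring_add)
qed

lemma colour_orbit_eqE:
  assumes "c \<in> proper_colourings G" "colour_orbit G c = colour_orbit G d"
  obtains k where "c = rotate_colouring G k d"
  using colour_orbit_self[OF assms(1)] assms(2) by (auto simp: colour_orbit_def)

text \<open>The two colourings are rotations of each other, and agreement at one vertex forces the
  shift to be 0.\<close>

lemma colour_orbit_eq_agree:
  assumes c: "c \<in> proper_colourings G" and d: "d \<in> proper_colourings G"
    and "colour_orbit G c = colour_orbit G d" "w \<in> verts G" "c w = d w"
  shows "c = d"
proof -
  obtain k where k: "c = rotate_colouring G k d" using colour_orbit_eqE assms by metis
  then have "k = 0" using assms by (metis add_cancel_right_right rotate_colouring_apply)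
  then show ?thesis using k rotate_colouring_0[OF proper_colouring_PiE[OF d]] by simp
qed

lemma rotate_proper_colouring:
  assumes "c \<in> proper_colourings (grid m n)"
  shows "rotate_colouring (grid m n) k c \<in> proper_colourings (grid m n)"
  using assms by (auto simp: proper_colourings_def rotate_colouring_def edge_grid_iff)

lemma local_extrema_rotate:
  "local_extrema (grid m n) s (rotate_colouring (grid m n) k c) = local_extrema (grid m n) s c"
  unfolding local_extrema_def by (auto simp: edge_grid_iff algebra_simps)

lemma differ_at_one_commute: "differ_at_one G c d \<longleftrightarrow> differ_at_one G d c"
  unfolding differ_at_one_def by metis

text \<open>This lets a flip between arbitrary representatives be rotated back to start at a chosen
  one.\<close>

lemma differ_at_one_rotate:
  "differ_at_one G (rotate_colouring G k c) d \<longleftrightarrow> differ_at_one G c (rotate_colouring G (- k) d)"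
proof -
  have "rotate_colouring G k c v \<noteq> d v \<longleftrightarrow> c v \<noteq> rotate_colouring G (- k) d v"
    if "v \<in> verts G" for v
    using that by (auto simp: algebra_simps)
  then show ?thesis unfolding differ_at_one_def by metis
qed

section \<open>Single flips and vertex degrees\<close>

definition recolourings :: "'a sgraph \<Rightarrow> ('a \<Rightarrow> 3) \<Rightarrow> ('a \<Rightarrow> 3) set" where
  "recolourings G c = {d \<in> proper_colourings G. differ_at_one G c d}"

lemma grid_neighbour:
  assumes "m \<ge> 2" "v \<in> verts (grid m n)"
  obtains u where "{u, v} \<in> edges (grid m n)"
proof -
  obtain i j where v: "v = (i, j)" by fastforce
  have "i + 1 \<le> m \<or> 1 \<le> i - 1 \<and> i - 1 + 1 = i" using assms by (auto simp: v verts_grid)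
  then show ?thesis
    using that[of "(i + 1, j)"] that[of "(i - 1, j)"] assms
    by (auto simp: v edge_grid_iff verts_grid grid_dist_eq_1_iff)
qed

lemma local_extrema_disjoint:
  assumes "m \<ge> 2"
  shows "local_extrema (grid m n) 1 c \<inter> local_extrema (grid m n) (- 1) c = {}"
proof -
  have False if v: "v \<in> local_extrema (grid m n) 1 c" "v \<in> local_extrema (grid m n) (- 1) c" for v
  proof -
    have "v \<in> verts (grid m n)" using v by (simp add: local_extrema_def)
    then obtain u where "{u, v} \<in> edges (grid m n)" using grid_neighbour assms by metis
    then have "c v + of_int 1 = c v + of_int (- 1)" using v local_extremaD by metis
    then show False by (simp add: mod3_of_int_eq_iff[of 1 "- 1", simplified])
  qed
  then show ?thesis by blast
qed

text \<open>A vertex can change colour only if its neighbours all share one colour, that is, at an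
  extremum, and then just one new colour is free.\<close>

lemma card_recolourings:
  assumes m: "m \<ge> 2" and c: "c \<in> proper_colourings (grid m n)"
  shows "card (recolourings (grid m n) c) =
    card (local_extrema (grid m n) 1 c) + card (local_extrema (grid m n) (- 1) c)"
proof -
  let ?G = "grid m n"
  let ?L = "local_extrema ?G 1 c" and ?U = "local_extrema ?G (- 1) c"
  \<comment> \<open>Neighbours of a minimum carry \<open>c v + 1\<close>, which leaves
    \<open>c v - 1\<close>; at a maximum the roles are exchanged.\<close>
  define new where "new v = (if v \<in> ?L then c v - 1 else c v + 1)" for v
  have new: "new v \<noteq> c v" for v
    by (simp add: new_def)
  have ext_edge: "new v \<noteq> c u" if "v \<in> ?L \<union> ?U" "{u, v} \<in> edges ?G" for u v
  proof -
    have "c u = c v + 1 \<and> new v = c v - 1 \<or> c u = c v - 1 \<and> new v = c v + 1"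
      using that local_extrema_disjoint[OF m, of n c]
        local_extremaD[of v ?G 1 c u] local_extremaD[of v ?G "- 1" c u]
      by (auto simp: new_def)
    moreover have "c v + 1 \<noteq> c v - 1"
      using mod3_exhaust[of "c v"] by auto
    ultimately show ?thesis by metis
  qed
  have "recolourings ?G c = (\<lambda>v. c(v := new v)) ` (?L \<union> ?U)"
  proof (intro equalityI subsetI)
    fix d assume "d \<in> recolourings ?G c"
    then have d: "d \<in> proper_colourings ?G" and "differ_at_one ?G c d"
      by (simp_all add: recolourings_def)
    then obtain v where v: "v \<in> verts ?G" "c v \<noteq> d v"
      and uniq: "\<And>w. w \<in> verts ?G \<Longrightarrow> w \<noteq> v \<Longrightarrow> c w = d w"
      unfolding differ_at_one_def by metis
    have nb: "d v = c v + 1 \<and> c u = c v - 1 \<or> d v = c v - 1 \<and> c u = c v + 1"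
      if e: "{u, v} \<in> edges ?G" for u
    proof (rule mod3_third_colour)
      have "u \<noteq> v" "u \<in> verts ?G" using e by (auto simp: edge_grid_iff grid_dist_def)
      then have "c u = d u" using uniq by simp
      then show "c u \<noteq> d v" using proper_colouring_edge[OF d e] by simp
      show "c u \<noteq> c v" using proper_colouring_edge[OF c e] .
    qed (use v in auto)
    have ne: "c v + 1 \<noteq> c v - 1" using mod3_exhaust[of "c v"] by auto
    \<comment> \<open>One actual neighbour narrows the new colour of \<open>v\<close> to two cases;
      in each, \<open>nb\<close> fixes the colours of all neighbours.\<close>
    obtain u0 where "{u0, v} \<in> edges ?G" using grid_neighbour[OF m v(1)] .
    then consider "d v = c v + 1" | "d v = c v - 1" using nb by blast
    then have "v \<in> ?L \<union> ?U \<and> d v = new v"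
    proof cases
      case 1
      then have "v \<in> ?U" using nb v ne by (auto simp: local_extrema_def)
      moreover have "v \<notin> ?L" using \<open>v \<in> ?U\<close> local_extrema_disjoint[OF m, of n c] by blast
      ultimately show ?thesis using 1 by (simp add: new_def)
    next
      case 2
      then have "v \<in> ?L" using nb v ne by (auto simp: local_extrema_def)
      then show ?thesis using 2 by (simp add: new_def)
    qed
    \<comment> \<open>Off the grid both colourings are \<open>undefined\<close>, so agreement on the
      grid outside \<open>v\<close> suffices.\<close>
    moreover have "d = c(v := d v)"
    proof
      fix w
      show "d w = (c(v := d v)) w"
        using uniq[of w] PiE_arb[OF proper_colouring_PiE[OF c], of w]
          PiE_arb[OF proper_colouring_PiE[OF d], of w]
        by (cases "w \<in> verts ?G") auto
    qed
    ultimately show "d \<in> (\<lambda>v. c(v := new v)) ` (?L \<union> ?U)"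
      by (intro image_eqI[of _ _ v]) simp_all
  next
    fix d assume "d \<in> (\<lambda>v. c(v := new v)) ` (?L \<union> ?U)"
    then obtain v where v: "v \<in> ?L \<union> ?U" and d: "d = c(v := new v)" by blast
    have vV: "v \<in> verts ?G" using v by (auto simp: local_extrema_def)
    have "d x \<noteq> d y" if e: "{x, y} \<in> edges ?G" for x y
    proof -
      have "x \<noteq> y" using e by (auto simp: edge_grid_iff grid_dist_def)
      moreover have "{y, x} \<in> edges ?G" using e by (simp add: insert_commute)
      ultimately show ?thesis
        using ext_edge[OF v, of x] ext_edge[OF v, of y] e proper_colouring_edge[OF c e]
        unfolding d by (cases "x = v"; cases "y = v") auto
    qed
    moreover have "d \<in> verts ?G \<rightarrow>\<^sub>E UNIV"
      using PiE_fun_upd[OF UNIV_I proper_colouring_PiE[OF c], of v "new v"] vV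
      by (simp add: d insert_absorb)
    ultimately have "d \<in> proper_colourings ?G" by (simp add: proper_colourings_def)
    moreover have "differ_at_one ?G c d"
      unfolding differ_at_one_def
    proof (rule ex1I)
      show "v \<in> verts ?G \<and> c v \<noteq> d v" using vV new[of v] d by simp
      show "w = v" if "w \<in> verts ?G \<and> c w \<noteq> d w" for w
        using that unfolding d by (cases "w = v") simp_all
    qed
    ultimately show "d \<in> recolourings ?G c" by (simp add: recolourings_def)
  qed
  moreover have "inj_on (\<lambda>v. c(v := new v)) (?L \<union> ?U)"
    using new by (intro inj_onI) (metis fun_upd_apply)
  ultimately have "card (recolourings ?G c) = card (?L \<union> ?U)"
    by (simp add: card_image)
  then show ?thesis
    using local_extrema_disjoint[OF m] by (simp add: card_Un_disjoint finite_local_extrema)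
qed

lemma verts_OFG: "verts (OFG m n) = colour_orbit (grid m n) ` proper_colourings (grid m n)"
  by (simp add: OFG_def Let_def)

text \<open>Two recolourings alter at most two vertices, so one of three given vertices is
  untouched. With \<open>colour_orbit_eq_agree\<close> this keeps different recolourings in
  different orbits.\<close>

lemma recolouring_agree:
  assumes "m \<ge> 2" "n \<ge> 2"
    and "d \<in> recolourings (grid m n) c" "d' \<in> recolourings (grid m n) c"
  obtains w where "w \<in> verts (grid m n)" "c w = d w" "c w = d' w"
proof -
  obtain v v' where "\<And>w. w \<in> verts (grid m n) \<Longrightarrow> w \<noteq> v \<Longrightarrow> c w = d w"
      "\<And>w. w \<in> verts (grid m n) \<Longrightarrow> w \<noteq> v' \<Longrightarrow> c w = d' w"
    using assms(3,4) unfolding recolourings_def differ_at_one_def by blast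
  moreover have "\<exists>w \<in> {(1, 1), (1, 2), (2, 1)}. w \<noteq> v \<and> w \<noteq> v'"
    by (cases v; cases v') auto
  moreover have "{(1, 1), (1, 2), (2, 1)} \<subseteq> verts (grid m n)"
    using assms by (auto simp: verts_grid)
  ultimately show ?thesis using that by blast
qed

text \<open>Every flip leaving the orbit of \<open>c\<close> can be rotated to start at
  \<open>c\<close> itself, so one representative sees all incident edges.\<close>

lemma edges_OFG_at_orbit:
  assumes mn: "m \<ge> 2" "n \<ge> 2" and c: "c \<in> proper_colourings (grid m n)"
  shows "{e \<in> edges (OFG m n). colour_orbit (grid m n) c \<in> e} =
    (\<lambda>d. {colour_orbit (grid m n) c, colour_orbit (grid m n) d}) ` recolourings (grid m n) c"
    (is "?E = ?f ` ?R")
proof -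
  let ?G = "grid m n"
  let ?orb = "colour_orbit ?G"
  have flip: "\<exists>d' \<in> ?R. ?orb d' = ?orb d"
    if d: "d \<in> proper_colourings ?G" and ab: "a \<in> ?orb c" "b \<in> ?orb d" "differ_at_one ?G a b" for a b d
  proof -
    obtain k l where "a = rotate_colouring ?G k c" "b = rotate_colouring ?G l d"
      using ab(1,2) unfolding colour_orbit_def by blast
    \<comment> \<open>Rotating both \<open>a\<close> and \<open>b\<close> by \<open>- k\<close>
      turns \<open>a\<close> into \<open>c\<close>.\<close>
    then have "rotate_colouring ?G (l - k) d \<in> ?R"
      using ab(3) rotate_proper_colouring[OF d]
      by (simp add: recolourings_def differ_at_one_rotate rotate_colouring_add)
    then show ?thesis using colour_orbit_rotate by blast
  qed
  show ?thesis
  proof (intro equalityI subsetI)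
    fix e assume "e \<in> ?E"
    then obtain d1 d2 a b where e: "e = {?orb d1, ?orb d2}" "?orb c \<in> e"
      and ab: "a \<in> ?orb d1" "b \<in> ?orb d2" "differ_at_one ?G a b"
      and d: "d1 \<in> proper_colourings ?G" "d2 \<in> proper_colourings ?G"
      by (auto simp: OFG_def Let_def)
    from e consider "?orb c = ?orb d1" | "?orb c = ?orb d2" by auto
    then show "e \<in> ?f ` ?R"
    proof cases
      case 1
      then obtain d' where "d' \<in> ?R" "?orb d' = ?orb d2" using flip[OF d(2)] ab by metis
      then show ?thesis using e 1 by (intro image_eqI[of _ _ d']) auto
    next
      case 2
      then obtain d' where "d' \<in> ?R" "?orb d' = ?orb d1"
        using flip[OF d(1)] ab differ_at_one_commute by metis
      then show ?thesis using e 2 by (intro image_eqI[of _ _ d']) auto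
    qed
  next
    fix e assume "e \<in> ?f ` ?R"
    then obtain d where d: "d \<in> ?R" "e = ?f d" by blast
    then have dp: "d \<in> proper_colourings ?G" "differ_at_one ?G c d"
      by (simp_all add: recolourings_def)
    \<comment> \<open>A flip leaves some vertex unchanged, so it is not a rotation and the two
      orbits are distinct.\<close>
    obtain w where "w \<in> verts ?G" "c w = d w"
      using recolouring_agree[OF mn d(1) d(1)] by metis
    then have "?orb c \<noteq> ?orb d"
      using colour_orbit_eq_agree[OF c dp(1)] dp(2) unfolding differ_at_one_def by metis
    moreover have "c \<in> ?orb c" "d \<in> ?orb d"
      by (rule colour_orbit_self[OF c], rule colour_orbit_self[OF dp(1)])
    ultimately show "e \<in> ?E"
      using c dp d(2) unfolding OFG_def Let_def by auto
  qed
qed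

text \<open>Two recolourings of \<open>c\<close> agree somewhere, so they are equal if they share an
  orbit; incident edges are therefore counted by recolourings.\<close>

lemma degree_OFG:
  assumes mn: "m \<ge> 2" "n \<ge> 2" and c: "c \<in> proper_colourings (grid m n)"
  shows "degree (OFG m n) (colour_orbit (grid m n) c) =
    card (local_extrema (grid m n) 1 c) + card (local_extrema (grid m n) (- 1) c)"
proof -
  let ?G = "grid m n"
  have "inj_on (\<lambda>d. {colour_orbit ?G c, colour_orbit ?G d}) (recolourings ?G c)"
  proof (rule inj_onI)
    fix d d' assume d: "d \<in> recolourings ?G c" "d' \<in> recolourings ?G c"
      and eq: "{colour_orbit ?G c, colour_orbit ?G d} = {colour_orbit ?G c, colour_orbit ?G d'}"
    obtain w where "w \<in> verts ?G" "d w = d' w"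
      using recolouring_agree[OF mn d] by metis
    moreover have "colour_orbit ?G d = colour_orbit ?G d'"
      using eq by (auto simp: doubleton_eq_iff)
    ultimately show "d = d'"
      using d colour_orbit_eq_agree[of d ?G d' w] by (simp add: recolourings_def)
  qed
  then show ?thesis
    unfolding degree_def edges_OFG_at_orbit[OF assms] card_recolourings[OF mn(1) c, symmetric]
    by (rule card_image)
qed

section \<open>Counting the orbits of degree 3\<close>

definition boundary_noncorners :: "nat \<Rightarrow> nat \<Rightarrow> (nat \<times> nat) set" where
  "boundary_noncorners m n = {1, m} \<times> {2..<n} \<union> {2..<m} \<times> {1, n}"

lemma card_boundary_noncorners:
  assumes "m \<ge> 2" "n \<ge> 2"
  shows "card (boundary_noncorners m n) = 2 * (m + n - 4)"
proof -
  have "({1, m} \<times> {2..<n}) \<inter> ({2..<m} \<times> {1, n}) = {}" by auto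
  then have "card (boundary_noncorners m n) = card ({1, m} \<times> {2..<n}) + card ({2..<m} \<times> {1, n})"
    unfolding boundary_noncorners_def by (intro card_Un_disjoint) auto
  then show ?thesis using assms by (simp add: card_cartesian_product)
qed

lemma boundary_noncorners_subset:
  assumes "m \<ge> 2" "n \<ge> 2"
  shows "boundary_noncorners m n \<subseteq> verts (grid m n)"
  using assms by (auto simp: boundary_noncorners_def verts_grid)

text \<open>The count is a product with one factor per coordinate of \<open>p\<close>: 1 if that
  coordinate is an end of its range, 2 otherwise. It is 2 when exactly one coordinate is an
  end.\<close>

lemma card_opposite_extrema:
  assumes p: "p \<in> verts (grid m n)" and s: "s = 1 \<or> s = - 1" and mn: "m \<ge> 2" "n \<ge> 2"
  shows "card (local_extrema (grid m n) (- s) (dist_colouring (grid m n) s p)) = 2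
    \<longleftrightarrow> p \<in> boundary_noncorners m n"
proof -
  obtain a b where ab: "p = (a, b)" by fastforce
  show ?thesis
    using p mn unfolding ab local_extrema_dist_colouring_opposite[OF p[unfolded ab] s mn]
    by (auto simp: card_cartesian_product card_far_ends boundary_noncorners_def verts_grid)
qed

theorem theorem3p3:
  fixes m n :: nat
  assumes "m \<ge> 2" and "n \<ge> 2"
  shows "card {A \<in> verts (OFG m n). degree (OFG m n) A = 3} = 4 * (m + n - 4)"
proof -
  let ?G = "grid m n"
  let ?orb = "colour_orbit ?G"
  let ?ext = "local_extrema ?G"
  let ?I = "{1, - 1 :: int} \<times> boundary_noncorners m n"
  define F where "F = (\<lambda>(s, p). ?orb (dist_colouring ?G s p))"
  have ne: "verts ?G \<noteq> {}" using assms by (auto simp: verts_grid)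
  have "{A \<in> verts (OFG m n). degree (OFG m n) A = 3} = F ` ?I"
  proof (intro equalityI subsetI)
    fix A assume "A \<in> {A \<in> verts (OFG m n). degree (OFG m n) A = 3}"
    then obtain c where c: "c \<in> proper_colourings ?G" and A: "A = ?orb c"
      and deg: "degree (OFG m n) A = 3"
      by (auto simp: verts_OFG)
    have sum: "card (?ext 1 c) + card (?ext (- 1) c) = 3"
      using deg degree_OFG[OF assms c] A by simp
    have "card (?ext s c) \<noteq> 0" if "s = 1 \<or> s = - 1" for s
      using local_extrema_nonempty[OF c that ne] finite_local_extrema by simp
    \<comment> \<open>Two positive counts with sum 3 are 1 and 2; \<open>s\<close> will be the sign
      of the kind that occurs once.\<close>
    from this[of 1] this[of "- 1"] sum
    have "card (?ext 1 c) = 1 \<and> card (?ext (- 1) c) = 2 \<or> card (?ext (- 1) c) = 1 \<and> card (?ext 1 c) = 2"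
      by simp linarith
    then obtain s :: int where s: "s = 1 \<or> s = - 1" and 1: "card (?ext s c) = 1" and 2: "card (?ext (- s) c) = 2"
      by (metis add.inverse_inverse)
    obtain p where p: "?ext s c = {p}" using 1 by (rule card_1_singletonE)
    then have pV: "p \<in> verts ?G" by (auto simp: local_extrema_def)
    \<comment> \<open>On the grid this is the distance formula around \<open>p\<close>, with
      \<open>c p\<close> as the shift; off the grid both sides are \<open>undefined\<close>.\<close>
    have rot: "c = rotate_colouring ?G (c p) (dist_colouring ?G s p)"
    proof
      fix v
      show "c v = rotate_colouring ?G (c p) (dist_colouring ?G s p) v"
        using unique_local_extremum[OF c s p, of v] PiE_arb[OF proper_colouring_PiE[OF c], of v]
        by (cases "v \<in> verts ?G") (simp_all add: dist_colouring_def rotate_colouring_def add.commute)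
    qed
    have "card (?ext (- s) (dist_colouring ?G s p)) = 2"
      using 2 local_extrema_rotate rot by metis
    then have "p \<in> boundary_noncorners m n"
      using card_opposite_extrema[OF pV s assms] by simp
    moreover have "A = F (s, p)"
      unfolding A F_def using rot colour_orbit_rotate by (metis case_prod_conv)
    ultimately show "A \<in> F ` ?I" using s by blast
  next
    fix A assume "A \<in> F ` ?I"
    then obtain s p where s: "s = 1 \<or> s = - 1" and p: "p \<in> boundary_noncorners m n"
      and A: "A = ?orb (dist_colouring ?G s p)"
      by (auto simp: F_def)
    have pV: "p \<in> verts ?G" using p boundary_noncorners_subset[OF assms] by blast
    have "card (?ext s (dist_colouring ?G s p)) + card (?ext (- s) (dist_colouring ?G s p)) = 3"
      using card_opposite_extrema[OF pV s assms] p local_extrema_dist_colouring[OF pV s] by simp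
    then have "degree (OFG m n) A = 3"
      unfolding A degree_OFG[OF assms dist_colouring_proper[OF s]] using s by auto
    then show "A \<in> {A \<in> verts (OFG m n). degree (OFG m n) A = 3}"
      using A dist_colouring_proper[OF s] by (auto simp: verts_OFG)
  qed
  moreover have "inj_on F ?I"
  proof (rule inj_onI, clarify)
    fix s p t q
    assume s: "s \<in> {1, - 1}" and t: "t \<in> {1, - 1 :: int}"
      and p: "p \<in> boundary_noncorners m n" and q: "q \<in> boundary_noncorners m n"
      and eq: "F (s, p) = F (t, q)"
    have s': "s = 1 \<or> s = - 1" and t': "t = 1 \<or> t = - 1" using s t by auto
    have pV: "p \<in> verts ?G" and qV: "q \<in> verts ?G"
      using p q boundary_noncorners_subset[OF assms] by auto
    obtain k where "dist_colouring ?G s p = rotate_colouring ?G k (dist_colouring ?G t q)"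
      using colour_orbit_eqE[OF dist_colouring_proper[OF s']] eq unfolding F_def by (metis case_prod_conv)
    \<comment> \<open>Sets of extrema are invariants of the orbit, so \<open>s\<close> and
      \<open>p\<close> can be recovered from it.\<close>
    then have ext: "?ext r (dist_colouring ?G s p) = ?ext r (dist_colouring ?G t q)" for r
      by (simp add: local_extrema_rotate)
    have p1: "?ext s (dist_colouring ?G s p) = {p}" and q1: "?ext t (dist_colouring ?G t q) = {q}"
      using local_extrema_dist_colouring pV qV s' t' by auto
    have "card (?ext (- t) (dist_colouring ?G t q)) = 2"
      using card_opposite_extrema[OF qV t' assms] q by simp
    \<comment> \<open>Otherwise one and the same set would be \<open>{p}\<close> and have two
      elements.\<close>
    then have "s \<noteq> - t" using p1 ext[of "- t"] by auto
    then have "s = t" using s' t' by auto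
    moreover from this have "{p} = {q}" using p1 q1 ext[of s] by metis
    ultimately show "s = t \<and> p = q" by simp
  qed
  ultimately have "card {A \<in> verts (OFG m n). degree (OFG m n) A = 3} = card ?I"
    by (simp add: card_image)
  also have "\<dots> = 4 * (m + n - 4)"
    by (simp add: card_cartesian_product card_boundary_noncorners[OF assms])
  finally show ?thesis .
qed

end
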